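(* Let $G$ be a finite abelian group, written additively, and let $G_2=\{x\in G \mid 2x=0\}$ be the subset (indeed, subgroup) of elements of $G$ of order at most $2$. Then: 1. There is a subset $A \subseteq G \setminus \{0\}$ with $2|A|=|G|+|G_2|-2$ for which $A \cup (2 \hat{\;} A) \neq G$. 2. If $A \subseteq G \setminus \{0\}$ satisfies $2|A| \geq |G|+|G_2|$, then $A \cup (2 \hat{\;} A) = G$.
   Context: For a subset $A$ of an additively written finite abelian group $G$ and a positive integer $h$, $h \hat{\;} A$ denotes the set of sums of the $h$-element subsets of $A$: $h \hat{\;} A = \{ \sum_{b \in B} b \mid B \subseteq A, |B|=h\}$. In particular, $2 \hat{\;} A=\{a_1+a_2 \mid a_1,a_2\in A,\ a_1\neq a_2\}$. *)

theory Defs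
  imports Main
begin

definition restricted_sumset :: "nat \<Rightarrow> 'a::ab_group_add set \<Rightarrow> 'a set" where
  "restricted_sumset h A = {\<Sum>b\<in>B. b | B. B \<subseteq> A \<and> card B = h}"

lemma restricted_sumset_2:
  "restricted_sumset 2 A = {a1 + a2 | a1 a2. a1 \<in> A \<and> a2 \<in> A \<and> a1 \<noteq> a2}"
proof (intro set_eqI iffI)
  fix x assume "x \<in> restricted_sumset 2 A"
  then show "x \<in> {a1 + a2 | a1 a2. a1 \<in> A \<and> a2 \<in> A \<and> a1 \<noteq> a2}"
    unfolding restricted_sumset_def card_2_iff by fastforce
next
  fix x assume "x \<in> {a1 + a2 | a1 a2. a1 \<in> A \<and> a2 \<in> A \<and> a1 \<noteq> a2}"
  then obtain a1 a2 where "x = a1 + a2" "a1 \<in> A" "a2 \<in> A" "a1 \<noteq> a2" by blast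
  then have "x = \<Sum>{a1, a2}" "{a1, a2} \<subseteq> A" "card {a1, a2} = 2" by auto
  then show "x \<in> restricted_sumset 2 A"
    unfolding restricted_sumset_def by blast
qed

definition two_torsion :: "'a::ab_group_add set" where
  "two_torsion = {x. x + x = 0}"

end

theory Submission
  imports Defs
begin

text \<open>Fix \<open>g\<close>. The reflection \<open>a \<mapsto> g - a\<close> is a bijection of \<open>G\<close>, so \<open>A\<close> and its mirror image
  \<open>g - A\<close> have equally many elements and \<open>2|A| = |A \<union> (g - A)| + |A \<inter> (g - A)|\<close>. An element \<open>a\<close> of the
  intersection writes \<open>g\<close> as \<open>a + (g - a)\<close> with both summands in \<open>A\<close>; hence \<open>g\<close> is missed by the
  restricted sums exactly when the intersection consists of solutions of \<open>a + a = g\<close>. These form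
  a coset of the 2-torsion subgroup or nothing. If \<open>A\<close> avoids both \<open>0\<close> and \<open>g\<close>, then the union
  avoids \<open>0\<close>, which gives \<open>2|A| \<le> (|G| - 1) + |G\<^sub>2|\<close> and thereby the second part.

  For the first part take \<open>g = 0\<close>. An inclusion-maximal set of nonzero elements in which no two distinct elements
  sum to \<open>0\<close> meets every nonzero pair \<open>{x, -x}\<close>, so the union is \<open>G \<setminus> {0}\<close> and the intersection is
  \<open>G\<^sub>2 \<setminus> {0}\<close>.\<close>

lemma card_reflection:
  fixes A :: "'a::{finite, ab_group_add} set"
  shows "2 * card A = card (A \<union> (\<lambda>a. g - a) ` A) + card (A \<inter> (\<lambda>a. g - a) ` A)"
proof -
  have "card ((\<lambda>a. g - a) ` A) = card A"
    by (rule card_image) (simp add: inj_on_def)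
  then show ?thesis
    using card_Un_Int[of A "(\<lambda>a. g - a) ` A"] by simp
qed

text \<open>Subtracting one fixed half of \<open>g\<close> maps all halves of \<open>g\<close> injectively into the 2-torsion
  subgroup.\<close>

lemma card_halves_le:
  fixes g :: "'a::{finite, ab_group_add}"
  shows "card {a. a + a = g} \<le> card (two_torsion :: 'a set)"
proof (cases "\<exists>c. c + c = g")
  case True
  then obtain c where c: "c + c = g" by blast
  show ?thesis
  proof (rule card_inj_on_le[where f = "\<lambda>a. a - c"])
    show "(\<lambda>a. a - c) ` {a. a + a = g} \<subseteq> two_torsion"
      using c by (auto simp: two_torsion_def algebra_simps)
  qed (auto simp: inj_on_def)
qed auto

text \<open>A missed element \<open>g\<close> makes the union with the reflected set avoid \<open>0\<close>, since \<open>g - a = 0\<close> would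
  put \<open>g\<close> into \<open>A\<close>, and makes the intersection consist of halves of \<open>g\<close>.\<close>

lemma card_less_if_missed:
  fixes A :: "'a::{finite, ab_group_add} set"
  assumes zero: "0 \<notin> A" and miss: "g \<notin> A \<union> restricted_sumset 2 A"
  shows "2 * card A < card (UNIV :: 'a set) + card (two_torsion :: 'a set)"
proof -
  let ?B = "(\<lambda>a. g - a) ` A"
  have "0 \<notin> A \<union> ?B"
    using zero miss by auto
  then have union: "card (A \<union> ?B) < card (UNIV :: 'a set)"
    by (intro psubset_card_mono) auto
  have "A \<inter> ?B \<subseteq> {a. a + a = g}"
  proof
    fix a assume "a \<in> A \<inter> ?B"
    then obtain b where "a \<in> A" "b \<in> A" "a + b = g" by auto
    with miss have "a = b" unfolding restricted_sumset_2 by blast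
    with \<open>a + b = g\<close> show "a \<in> {a. a + a = g}" by simp
  qed
  then have "card (A \<inter> ?B) \<le> card {a. a + a = g}"
    by (intro card_mono) auto
  also have "\<dots> \<le> card (two_torsion :: 'a set)"
    by (rule card_halves_le)
  finally show ?thesis
    using union card_reflection[of A g] by linarith
qed

text \<open>Since \<open>|G| + |G\<^sub>2|\<close> is even, this set is as large as the preceding strict bound permits. The nonzero
  2-torsion elements all fit into the set because each is only excluded from being added to itself,
  and of every other pair \<open>{x, -x}\<close> exactly one member fits. Maximality makes this choice of
  representatives.\<close>

lemma exists_large_set_missing_zero:
  "\<exists>A :: 'a::{finite, ab_group_add} set. 0 \<notin> A \<and> 0 \<notin> restricted_sumset 2 A \<and>
     2 * card A = card (UNIV :: 'a set) + card (two_torsion :: 'a set) - 2"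
proof -
  define \<F> where "\<F> = {A :: 'a set. 0 \<notin> A \<and> 0 \<notin> restricted_sumset 2 A}"
  have "{} \<in> \<F>" by (simp add: \<F>_def restricted_sumset_2)
  then obtain A where A: "A \<in> \<F>" and maximal: "\<And>B. B \<in> \<F> \<Longrightarrow> A \<subseteq> B \<Longrightarrow> A = B"
    using finite_has_maximal[of \<F>] by auto
  have zero: "0 \<notin> A" and miss: "0 \<notin> restricted_sumset 2 A"
    using A by (auto simp: \<F>_def)
  have cover: "- x \<in> A" if "x \<noteq> 0" "x \<notin> A" for x
  proof (rule ccontr)
    assume "- x \<notin> A"
    then have "0 \<noteq> x + a \<and> 0 \<noteq> a + x" if "a \<in> A" for a
      using that by (metis add.commute minus_unique)
    then have "insert x A \<in> \<F>"
      using zero miss \<open>x \<noteq> 0\<close> unfolding \<F>_def restricted_sumset_2 by blast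
    with maximal[of "insert x A"] \<open>x \<notin> A\<close> show False by blast
  qed
  let ?B = "(\<lambda>a. 0 - a) ` A"
  have "A \<union> ?B = UNIV - {0}"
  proof
    show "A \<union> ?B \<subseteq> UNIV - {0}" using zero by auto
    show "UNIV - {0} \<subseteq> A \<union> ?B"
    proof
      fix x :: 'a assume "x \<in> UNIV - {0}"
      then have "x \<in> A \<or> - x \<in> A" using cover by blast
      then show "x \<in> A \<union> ?B" by (auto intro: image_eqI[where x = "- x"])
    qed
  qed
  then have union: "card (A \<union> ?B) = card (UNIV :: 'a set) - 1"
    by (simp add: card_Diff_singleton)
  have "A \<inter> ?B = two_torsion - {0}"
  proof
    show "A \<inter> ?B \<subseteq> two_torsion - {0}"
    proof
      fix a assume "a \<in> A \<inter> ?B"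
      then obtain b where "a \<in> A" "b \<in> A" "0 = a + b" by auto
      moreover from this miss have "a = b" unfolding restricted_sumset_2 by blast
      ultimately show "a \<in> two_torsion - {0}" using zero by (auto simp: two_torsion_def)
    qed
    show "two_torsion - {0} \<subseteq> A \<inter> ?B"
    proof
      fix x :: 'a assume x: "x \<in> two_torsion - {0}"
      then have "- x = x" by (simp add: two_torsion_def minus_unique)
      moreover have "x \<in> A" using x cover[of x] \<open>- x = x\<close> by auto
      ultimately show "x \<in> A \<inter> ?B" by (auto intro: image_eqI[where x = x])
    qed
  qed
  moreover have torsion_zero: "(0 :: 'a) \<in> two_torsion" by (simp add: two_torsion_def)
  ultimately have inter: "card (A \<inter> ?B) = card (two_torsion :: 'a set) - 1"
    by (simp add: card_Diff_singleton)
  \<comment> \<open>Both sets contain \<open>0\<close>, so the truncated subtractions of \<open>1\<close> combine to one of \<open>2\<close>.\<close>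
  have "card (UNIV :: 'a set) > 0" "card (two_torsion :: 'a set) > 0"
    using torsion_zero by (auto simp: card_gt_0_iff)
  then have "2 * card A = card (UNIV :: 'a set) + card (two_torsion :: 'a set) - 2"
    using card_reflection[of A 0] union inter by linarith
  with zero miss show ?thesis by blast
qed

theorem proposition3:
  shows "(\<exists>A :: 'a::{finite, ab_group_add} set. A \<subseteq> UNIV - {0} \<and>
            2 * card A = card (UNIV :: 'a set) + card (two_torsion :: 'a set) - 2 \<and>
            A \<union> restricted_sumset 2 A \<noteq> UNIV) \<and>
         (\<forall>A :: 'a set. A \<subseteq> UNIV - {0} \<and>
            2 * card A \<ge> card (UNIV :: 'a set) + card (two_torsion :: 'a set) \<longrightarrow>
            A \<union> restricted_sumset 2 A = UNIV)"
proof (intro conjI allI impI)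
  obtain A :: "'a set" where "0 \<notin> A" "0 \<notin> restricted_sumset 2 A"
    "2 * card A = card (UNIV :: 'a set) + card (two_torsion :: 'a set) - 2"
    using exists_large_set_missing_zero by blast
  then show "\<exists>A :: 'a set. A \<subseteq> UNIV - {0} \<and>
      2 * card A = card (UNIV :: 'a set) + card (two_torsion :: 'a set) - 2 \<and>
      A \<union> restricted_sumset 2 A \<noteq> UNIV"
    by (intro exI[of _ A]) blast
next
  fix A :: "'a set"
  assume A: "A \<subseteq> UNIV - {0} \<and>
    2 * card A \<ge> card (UNIV :: 'a set) + card (two_torsion :: 'a set)"
  then have "g \<in> A \<union> restricted_sumset 2 A" for g
    using card_less_if_missed[of A g] by (meson Diff_iff insertI1 not_le subsetD)
  then show "A \<union> restricted_sumset 2 A = UNIV" by blast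
qed

end
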